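(* Let $K$ be a positive integer and let $F:\mathbb{R}_+^K\to\mathbb{R}_+$ be a function. (i) If $F$ is an e-merging function, then $F\le M_{\boldsymbol\lambda}$ (pointwise on $\mathbb{R}_+^K$) for some $\boldsymbol\lambda\in\Delta_{K+1}$. (ii) $F$ is an admissible e-merging function if and only if $F=M_{\boldsymbol\lambda}$ for some $\boldsymbol\lambda\in\Delta_{K+1}$.
   Context: Notation: $\mathbb{R}_+=[0,\infty)$, and $\Delta_n=\{(x_1,\dots,x_n)\in[0,1]^n:\sum_{k=1}^n x_k=1\}$ is the standard simplex. For $\boldsymbol\lambda=(\lambda_1,\dots,\lambda_{K+1})\in\Delta_{K+1}$, the function $M_{\boldsymbol\lambda}:\mathbb{R}_+^K\to\mathbb{R}_+$ is defined by $M_{\boldsymbol\lambda}(e_1,\dots,e_K)=\sum_{k=1}^K\lambda_k e_k+\lambda_{K+1}$. A hypothesis is a collection $\mathcal H$ of probability measures on a measurable space $(\Omega,\mathcal F)$. An e-variable for $\mathcal H$ is a $[0,\infty]$-valued random variable $E$ with $\mathbb{E}^{\mathbb{P}}[E]\le 1$ for all $\mathbb{P}\in\mathcal H$. An e-merging function (of dimension $K$) is an increasing Borel function $F:\mathbb{R}_+^K\to\mathbb{R}_+$ such that for any hypothesis, $F(E_1,\dots,E_K)$ is an e-variable for any e-variables $E_1,\dots,E_K$, with arbitrary dependence among them. Here "increasing" means componentwise non-decreasing. Infinite values of e-variables are disregarded, as the domain of $F$ contains only finite points. Standing convention: it is necessary and sufficient to consider a simple hypothesis $\{\mathbb{P}\}$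 with $\mathbb{P}$ a fixed atomless probability measure, so all e-variables are defined for this fixed $\{\mathbb{P}\}$. That is, an e-variable is a nonnegative random variable (finite almost surely) on the atomless probability space $(\Omega,\mathcal F,\mathbb{P})$ with $\mathbb{E}[E]\le1$, where $\mathbb{E}$ is expectation under $\mathbb{P}$, and $F$ is e-merging when it is increasing, Borel, and $\mathbb{E}[F(E_1,\dots,E_K)]\le 1$ for all e-variables $E_1,\dots,E_K$. An e-merging function $F$ is admissible if for any e-merging function $G$ (of the same dimension $K$), $G\ge F$ implies $G=F$. All equalities and inequalities between functions are pointwise. *)

theory Defs
  imports "HOL-Probability.Probability"
begin

definition std_simplex :: "(real ^ 'n) set" where
  "std_simplex = {x. (\<forall>k. x $ k \<in> {0..1}) \<and> (\<Sum>k\<in>UNIV. x $ k) = 1}"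

definition nonneg_orthant :: "(real ^ 'k) set" where
  "nonneg_orthant = {x. \<forall>k. 0 \<le> x $ k}"

text \<open>
  The \<open>K + 1\<close> weights are indexed by \<^typ>\<open>'k option\<close>, where \<open>K\<close> is the cardinality of the
  finite type \<open>'k\<close>: \<^term>\<open>Some k\<close> is the index of the weight of the argument \<open>k\<close>, and
  \<^term>\<open>None\<close> is the last index \<open>K + 1\<close>, the one of the constant term.
\<close>

definition weighted_mean :: "real ^ ('k option) \<Rightarrow> real ^ 'k \<Rightarrow> real" where
  "weighted_mean w e = (\<Sum>k\<in>UNIV. w $ Some k * e $ k) + w $ None"

definition atomless :: "'a measure \<Rightarrow> bool" where
  "atomless P \<longleftrightarrow>
     (\<forall>A\<in>sets P. 0 < emeasure P A \<longrightarrow>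
        (\<exists>B\<in>sets P. B \<subseteq> A \<and> 0 < emeasure P B \<and> emeasure P B < emeasure P A))"

definition e_variable :: "'a measure \<Rightarrow> ('a \<Rightarrow> ennreal) \<Rightarrow> bool" where
  "e_variable P E \<longleftrightarrow> E \<in> borel_measurable P \<and> (\<integral>\<^sup>+ \<omega>. E \<omega> \<partial>P) \<le> 1"

text \<open>
  Functions from the nonnegative orthant to the nonnegative reals are represented by total
  functions of which only the values on the orthant matter. An e-variable is almost surely
  finite, so the value that \<^const>\<open>enn2real\<close> gives to \<open>\<infinity>\<close> is used on a null set only.
  The relation \<open>\<le>\<close> on vectors, used by \<^const>\<open>mono_on\<close>, is the componentwise one.
\<close>

definition e_merging :: "'a measure \<Rightarrow> (real ^ 'k \<Rightarrow> real) \<Rightarrow> bool" where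
  "e_merging P F \<longleftrightarrow>
     F \<in> nonneg_orthant \<rightarrow> {0..} \<and>
     mono_on nonneg_orthant F \<and>
     F \<in> borel_measurable (restrict_space borel nonneg_orthant) \<and>
     (\<forall>E :: 'k \<Rightarrow> 'a \<Rightarrow> ennreal. (\<forall>k. e_variable P (E k)) \<longrightarrow>
        e_variable P (\<lambda>\<omega>. ennreal (F (\<chi> k. enn2real (E k \<omega>)))))"

definition admissible_e_merging :: "'a measure \<Rightarrow> (real ^ 'k \<Rightarrow> real) \<Rightarrow> bool" where
  "admissible_e_merging P F \<longleftrightarrow>
     e_merging P F \<and>
     (\<forall>G. e_merging P G \<longrightarrow> (\<forall>x\<in>nonneg_orthant. F x \<le> G x) \<longrightarrow>
        (\<forall>x\<in>nonneg_orthant. G x = F x))"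

end

theory Submission
  imports Defs
begin

text \<open>
  The crux is part (i); it is a separation argument. Let \<open>x\<close> range over finitely many points of
  the orthant with probability weights \<open>u\<close> such that the mean \<open>\<Sum> u x * x\<close> is at most \<open>1\<close> in
  every coordinate. An atomless space carries a random vector with exactly this distribution
  (\<open>atomless_disjoint_family\<close>), and its coordinates are e-variables. Hence an e-merging
  function \<open>F\<close> satisfies \<open>\<Sum> u x * F x \<le> 1\<close> (\<open>e_merging_finite_mean_le_one\<close>). This says that the
  convex hull of the graph of \<open>F\<close> misses the convex set of all \<open>(y, t)\<close> with \<open>y \<le> 1\<close>
  coordinatewise and \<open>t > 1\<close>. A hyperplane that separates the two sets is the graph of an affine
  function above \<open>F\<close>. The shape of the second set makes its slopes nonnegative and its value at
  \<open>(1, \<dots>, 1)\<close> at most \<open>1\<close>, while \<open>F 0 \<ge> 0\<close> makes its constant term nonnegative, so that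
  it is dominated by a weighted mean (\<open>dominated_by_weighted_mean\<close>).

  Part (ii) follows by comparison. Weighted means are e-merging by linearity of expectation, so an
  admissible function equals the weighted mean that part (i) puts above it. Conversely, anything
  e-merging above a weighted mean lies below another weighted mean, and one weighted mean
  dominates another only if they coincide, since the weights of both sum to \<open>1\<close>
  (\<open>weighted_mean_le_imp_eq\<close>).
\<close>

section \<open>Atomless measures attain all intermediate values\<close>

text \<open>
  Of the two parts into which an atomless measure splits \<open>A\<close>, the lighter one will do.
\<close>

lemma atomless_split_half:
  assumes "finite_measure P" "atomless P" "A \<in> sets P" "0 < measure P A"
  obtains B where "B \<in> sets P" "B \<subseteq> A" "0 < measure P B" "measure P B \<le> measure P A / 2"
proof -
  interpret finite_measure P by fact
  have "0 < emeasure P A" using assms(4) by (simp add: emeasure_eq_measure)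
  with assms(2,3) obtain B where "B \<in> sets P" "B \<subseteq> A"
      "0 < emeasure P B" "emeasure P B < emeasure P A"
    unfolding atomless_def by blast
  then have B: "B \<in> sets P" "B \<subseteq> A" "0 < measure P B" "measure P B < measure P A"
    by (simp_all add: emeasure_eq_measure ennreal_less_iff)
  have "measure P (A - B) = measure P A - measure P B"
    using B assms(3) by (intro finite_measure_Diff) auto
  then show thesis
    using B assms(3) that[of B] that[of "A - B"] by (cases "measure P B \<le> measure P A / 2") auto
qed

lemma atomless_small_subset:
  assumes "finite_measure P" "atomless P" "A \<in> sets P" "0 < measure P A" "0 < \<epsilon>"
  obtains B where "B \<in> sets P" "B \<subseteq> A" "0 < measure P B" "measure P B < \<epsilon>"
proof -
  have "\<exists>B\<in>sets P. B \<subseteq> A \<and> 0 < measure P B \<and> measure P B \<le> measure P A / 2 ^ n" for n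
  proof (induction n)
    case 0
    show ?case using assms by (intro bexI[of _ A]) auto
  next
    case (Suc n)
    then obtain B where B: "B \<in> sets P" "B \<subseteq> A" "0 < measure P B"
        "measure P B \<le> measure P A / 2 ^ n" by blast
    obtain C where "C \<in> sets P" "C \<subseteq> B" "0 < measure P C" "measure P C \<le> measure P B / 2"
      using atomless_split_half[OF assms(1,2) B(1,3)] .
    moreover from this have "measure P C \<le> measure P A / 2 ^ Suc n"
      using B(4) by simp
    ultimately show ?case using B(2) by blast
  qed
  moreover obtain n where "measure P A / \<epsilon> < 2 ^ n"
    using real_arch_pow[of 2] by auto
  then have "measure P A / 2 ^ n < \<epsilon>"
    using assms(5) by (simp add: field_simps)
  ultimately show thesis
    using that by (meson le_less_trans)
qed

text \<open>
  Sierpinski's theorem. A set of measure \<open>t\<close> is built greedily: among the subsets of \<open>A\<close> of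
  measure at most \<open>t\<close>, step \<open>n\<close> enlarges the current one to a set whose measure is within
  \<open>1 / (n + 1)\<close> of the best extension. If the union of the chain still had measure below \<open>t\<close>,
  a small piece of the rest of \<open>A\<close> could be added to it, and the union would be improvable by a
  fixed amount at every step.
\<close>

lemma atomless_intermediate_measure:
  assumes "finite_measure P" "atomless P" "A \<in> sets P" "0 \<le> t" "t \<le> measure P A"
  obtains B where "B \<in> sets P" "B \<subseteq> A" "measure P B = t"
proof -
  interpret finite_measure P by fact
  define adm where "adm = (\<lambda>B. B \<in> sets P \<and> B \<subseteq> A \<and> measure P B \<le> t)"
  have step: "\<exists>B'. adm B' \<and> B \<subseteq> B' \<and>
      (\<forall>C. adm C \<and> B \<subseteq> C \<longrightarrow> measure P C \<le> measure P B' + 1 / Suc n)" if "adm B" for B n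
  proof -
    let ?V = "measure P ` {C. adm C \<and> B \<subseteq> C}"
    have bdd: "bdd_above ?V" by (auto simp: adm_def bdd_above_def)
    have "Sup ?V - 1 / Suc n < Sup ?V" by simp
    moreover have "?V \<noteq> {}" using that by auto
    ultimately obtain B' where "adm B'" "B \<subseteq> B'" "Sup ?V - 1 / Suc n < measure P B'"
      using less_cSup_iff[OF _ bdd, of "Sup ?V - 1 / Suc n"] by blast
    moreover have "measure P C \<le> Sup ?V" if "adm C" "B \<subseteq> C" for C
      using that by (intro cSup_upper bdd) auto
    ultimately show ?thesis by (intro exI[of _ B']) fastforce
  qed
  have "adm {}" using assms by (simp add: adm_def)
  then have "\<exists>B. \<forall>n. adm (B n) \<and> (B n \<subseteq> B (Suc n) \<and>
      (\<forall>C. adm C \<and> B n \<subseteq> C \<longrightarrow> measure P C \<le> measure P (B (Suc n)) + 1 / Suc n))"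
    using step by (intro dependent_nat_choice) blast+
  then obtain B where adm: "\<And>n. adm (B n)" and inc: "\<And>n. B n \<subseteq> B (Suc n)"
    and greedy: "\<And>n C. adm C \<Longrightarrow> B n \<subseteq> C \<Longrightarrow> measure P C \<le> measure P (B (Suc n)) + 1 / Suc n"
    by blast
  define U where "U = (\<Union>n. B n)"
  have U: "U \<in> sets P" "U \<subseteq> A" using adm by (auto simp: U_def adm_def)
  have "(\<lambda>n. measure P (B n)) \<longlonglongrightarrow> measure P U"
    unfolding U_def using adm inc
    by (intro finite_Lim_measure_incseq) (auto simp: adm_def incseq_Suc_iff)
  then have le: "measure P U \<le> t"
    using adm by (intro LIMSEQ_le_const2[of _ _ t]) (auto simp: adm_def)
  have "measure P U = t"
  proof (rule ccontr)
    assume "measure P U \<noteq> t"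
    with le have lt: "measure P U < t" by simp
    have "0 < measure P (A - U)"
      using U assms lt by (subst finite_measure_Diff) auto
    then obtain D where D: "D \<in> sets P" "D \<subseteq> A - U" "0 < measure P D" "measure P D < t - measure P U"
      using atomless_small_subset[OF assms(1,2), of "A - U" "t - measure P U"] U assms lt by auto
    have UD: "measure P (U \<union> D) = measure P U + measure P D"
      using U D by (intro finite_measure_Union) auto
    with U D have "adm (U \<union> D)" by (auto simp: adm_def)
    have "measure P D \<le> 1 / Suc n" for n
    proof -
      have "measure P (U \<union> D) \<le> measure P (B (Suc n)) + 1 / Suc n"
        using \<open>adm (U \<union> D)\<close> by (intro greedy) (auto simp: U_def)
      moreover have "measure P (B (Suc n)) \<le> measure P U"
        using U by (intro finite_measure_mono) (auto simp: U_def)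
      ultimately show ?thesis using UD by simp
    qed
    moreover obtain n where "1 / Suc n < measure P D"
      using nat_approx_posE[OF D(3)] by auto
    ultimately show False by (meson not_le)
  qed
  with U show thesis using that by blast
qed

lemma atomless_disjoint_family:
  assumes "finite_measure P" "atomless P" "finite S" "\<And>i. i \<in> S \<Longrightarrow> 0 \<le> u i"
    "sum u S \<le> measure P (space P)"
  obtains A where "disjoint_family_on A S" "\<And>i. i \<in> S \<Longrightarrow> A i \<in> sets P"
    "\<And>i. i \<in> S \<Longrightarrow> measure P (A i) = u i"
proof -
  interpret finite_measure P by fact
  have "\<exists>A. disjoint_family_on A S \<and> (\<forall>i\<in>S. A i \<in> sets P \<and> measure P (A i) = u i)"
    using assms(3-5)
  proof (induction S rule: finite_induct)
    case empty
    show ?case by (simp add: disjoint_family_on_def)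
  next
    case (insert j S)
    have "0 \<le> u j" using insert.prems by auto
    then have "sum u S \<le> measure P (space P)" using insert.hyps insert.prems(2) by simp
    with insert obtain A where A: "disjoint_family_on A S"
        "\<And>i. i \<in> S \<Longrightarrow> A i \<in> sets P" "\<And>i. i \<in> S \<Longrightarrow> measure P (A i) = u i"
      by auto
    let ?U = "\<Union>i\<in>S. A i"
    have U: "?U \<in> sets P" using A insert by auto
    have "measure P ?U = sum u S"
      using A insert by (subst finite_measure_finite_Union) auto
    then have "u j \<le> measure P (space P - ?U)"
      using insert U sets.sets_into_space[OF U] by (subst finite_measure_Diff) auto
    then obtain B where B: "B \<in> sets P" "B \<subseteq> space P - ?U" "measure P B = u j"
      using atomless_intermediate_measure[OF assms(1,2) sets.compl_sets[OF U] \<open>0 \<le> u j\<close>] by metis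
    have "A i \<inter> B = {}" if "i \<in> S" for i
      using B(2) that by blast
    with A(1) insert.hyps(2) have "disjoint_family_on (A(j := B)) (insert j S)"
      by (fastforce simp: disjoint_family_on_def)
    moreover have "\<forall>i\<in>insert j S. (A(j := B)) i \<in> sets P \<and> measure P ((A(j := B)) i) = u i"
      using A(2,3) B(1,3) insert.hyps(2) by auto
    ultimately show ?case by blast
  qed
  with that show thesis by blast
qed

section \<open>E-merging functions on simple random vectors\<close>

text \<open>
  The weighted points are realized as the distribution of a random vector that equals \<open>x i\<close> on a
  set of probability \<open>u i\<close>. It is \<open>0\<close> on the remaining null set, where \<open>F\<close> is nonnegative,
  so that the bound for the expectation of \<open>F\<close> suffices and the sets need not cover the space.
\<close>

lemma e_merging_finite_mean_le_one:
  fixes F :: "real ^ 'k \<Rightarrow> real" and x :: "'i \<Rightarrow> real ^ 'k"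
  assumes "prob_space P" "atomless P" "e_merging P F" "finite S"
    and x: "\<And>i. i \<in> S \<Longrightarrow> x i \<in> nonneg_orthant"
    and u: "\<And>i. i \<in> S \<Longrightarrow> 0 \<le> u i" "sum u S = 1"
    and mean: "\<And>k. (\<Sum>i\<in>S. u i * x i $ k) \<le> 1"
  shows "(\<Sum>i\<in>S. u i * F (x i)) \<le> 1"
proof -
  interpret prob_space P by fact
  obtain A where disj: "disjoint_family_on A S" and A: "\<And>i. i \<in> S \<Longrightarrow> A i \<in> sets P"
    and mA: "\<And>i. i \<in> S \<Longrightarrow> measure P (A i) = u i"
    using atomless_disjoint_family[of P S u] assms finite_measure_axioms
    by (auto simp: prob_space)
  have F0: "0 \<le> F y" if "y \<in> nonneg_orthant" for y
    using assms(3) that by (auto simp: e_merging_def)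
  have int: "(\<integral>\<^sup>+\<omega>. (\<Sum>i\<in>S. ennreal (c i) * indicator (A i) \<omega>) \<partial>P) = ennreal (\<Sum>i\<in>S. u i * c i)"
    if "\<And>i. i \<in> S \<Longrightarrow> 0 \<le> c i" for c
  proof -
    have "(\<integral>\<^sup>+\<omega>. (\<Sum>i\<in>S. ennreal (c i) * indicator (A i) \<omega>) \<partial>P)
        = (\<Sum>i\<in>S. ennreal (c i) * emeasure P (A i))"
      using A by (subst nn_integral_sum) (auto simp: nn_integral_cmult_indicator)
    also have "\<dots> = (\<Sum>i\<in>S. ennreal (u i * c i))"
      using that u by (intro sum.cong) (auto simp: emeasure_eq_measure mA ennreal_mult mult.commute)
    finally show ?thesis using that u by (simp add: sum_ennreal)
  qed
  define E where "E = (\<lambda>k \<omega>. \<Sum>i\<in>S. ennreal (x i $ k) * indicator (A i) \<omega>)"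
  have "e_variable P (E k)" for k
    unfolding e_variable_def
  proof
    show "E k \<in> borel_measurable P" unfolding E_def using A by measurable
    show "(\<integral>\<^sup>+\<omega>. E k \<omega> \<partial>P) \<le> 1"
      unfolding E_def using x mean[of k]
      by (subst int) (auto simp: nonneg_orthant_def)
  qed
  with assms(3) have le1: "(\<integral>\<^sup>+\<omega>. ennreal (F (\<chi> k. enn2real (E k \<omega>))) \<partial>P) \<le> 1"
    unfolding e_merging_def e_variable_def by blast
  have "(\<Sum>i\<in>S. ennreal (F (x i)) * indicator (A i) \<omega>) \<le> ennreal (F (\<chi> k. enn2real (E k \<omega>)))" for \<omega>
  proof (cases "\<exists>i\<in>S. \<omega> \<in> A i")
    case True
    then obtain j where j: "j \<in> S" "\<omega> \<in> A j" by blast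
    have ind: "indicator (A i) \<omega> = (if i = j then 1 else 0 :: ennreal)" if "i \<in> S" for i
      using that j disj by (auto simp: disjoint_family_on_def indicator_def)
    have sing: "(\<Sum>i\<in>S. ennreal (c i) * indicator (A i) \<omega>) = ennreal (c j)" for c
      using assms(4) j by (simp add: ind if_distrib sum.delta cong: sum.cong if_cong)
    have "(\<chi> k. enn2real (E k \<omega>)) = x j"
      using x[OF j(1)] by (simp add: vec_eq_iff E_def sing nonneg_orthant_def)
    then show ?thesis by (simp add: sing)
  next
    case False
    then have "(\<Sum>i\<in>S. ennreal (F (x i)) * indicator (A i) \<omega>) = 0"
      by (auto intro!: sum.neutral)
    then show ?thesis by simp
  qed
  then have "ennreal (\<Sum>i\<in>S. u i * F (x i)) \<le> 1"
    using int[of "\<lambda>i. F (x i)"] F0 x le1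
    by (metis (no_types, lifting) nn_integral_mono order_trans)
  then show ?thesis by (simp add: ennreal_le_iff2 flip: ennreal_1)
qed

section \<open>Domination by a weighted mean\<close>

text \<open>
  The second hypothesis is all that the e-merging property contributes; the rest is convex
  geometry. The separating functional is \<open>(x, t) \<mapsto> a \<bullet> x + b * t\<close>, at most \<open>c\<close> on the hull \<open>C\<close>
  of the graph and at least \<open>c\<close> on \<open>D\<close>. As \<open>D\<close> is unbounded downwards in each coordinate and
  upwards in the last one, \<open>a \<le> 0 \<le> b\<close>. The hyperplane is not vertical: for \<open>b = 0\<close>, comparing
  the point \<open>0\<close> of the orthant with \<open>(1, \<dots>, 1)\<close> would force \<open>a = 0\<close>. Solving for the last
  coordinate gives the weights \<open>- a / b\<close>, and the corner \<open>(1, \<dots>, 1)\<close>, \<open>t = 1\<close> of the closure of \<open>D\<close> bounds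
  the constant term.
\<close>

lemma dominated_by_weighted_mean:
  fixes F :: "real ^ 'k \<Rightarrow> real"
  assumes F0: "0 \<le> F 0"
    and mean: "\<And>S u. \<lbrakk>finite S; S \<subseteq> nonneg_orthant; \<And>x. x \<in> S \<Longrightarrow> 0 \<le> u x; sum u S = 1;
        \<And>k. (\<Sum>x\<in>S. u x * x $ k) \<le> 1\<rbrakk> \<Longrightarrow> (\<Sum>x\<in>S. u x * F x) \<le> 1"
  obtains w where "w \<in> std_simplex" "\<And>e. e \<in> nonneg_orthant \<Longrightarrow> F e \<le> weighted_mean w e"
proof -
  define C where "C = convex hull ((\<lambda>x. (x, F x)) ` nonneg_orthant)"
  define D :: "((real ^ 'k) \<times> real) set" where "D = {(y, t). (\<forall>k. y $ k \<le> 1) \<and> 1 < t}"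
  have zero: "(0 :: real ^ 'k) \<in> nonneg_orthant" by (simp add: nonneg_orthant_def)
  have "C \<inter> D = {}"
  proof (rule ccontr)
    assume "C \<inter> D \<noteq> {}"
    then obtain y t where yt: "(y, t) \<in> C" "\<And>k. y $ k \<le> 1" "1 < t" by (auto simp: D_def)
    from yt(1) obtain T v where T: "finite T" "T \<subseteq> (\<lambda>x. (x, F x)) ` nonneg_orthant"
        "\<And>p. p \<in> T \<Longrightarrow> 0 \<le> v p" "sum v T = 1" "(\<Sum>p\<in>T. v p *\<^sub>R p) = (y, t)"
      unfolding C_def convex_hull_explicit by blast
    define S where "S = fst ` T"
    define u where "u = (\<lambda>x. v (x, F x))"
    have T_eq: "T = (\<lambda>x. (x, F x)) ` S" and inj: "inj_on (\<lambda>x. (x, F x)) S"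
      using T(2) by (force simp: S_def inj_on_def)+
    have sumT: "sum g T = (\<Sum>x\<in>S. g (x, F x))" for g :: "_ \<Rightarrow> 'z::comm_monoid_add"
      unfolding T_eq by (subst sum.reindex[OF inj]) simp
    have "y = (\<Sum>x\<in>S. u x *\<^sub>R x)" "t = (\<Sum>x\<in>S. u x * F x)"
      using arg_cong[OF T(5), of fst] arg_cong[OF T(5), of snd]
      by (simp_all add: fst_sum snd_sum sumT u_def)
    moreover have "(\<Sum>x\<in>S. u x * F x) \<le> 1"
    proof (rule mean)
      show "finite S" "S \<subseteq> nonneg_orthant" using T by (auto simp: S_def)
      show "\<And>x. x \<in> S \<Longrightarrow> 0 \<le> u x" "sum u S = 1"
        using T(3,4) by (auto simp: T_eq u_def sum.reindex[OF inj])
      show "(\<Sum>x\<in>S. u x * x $ k) \<le> 1" for k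
        using yt(2)[of k] \<open>y = _\<close> by simp
    qed
    ultimately show False using yt(3) by simp
  qed
  moreover have "convex D"
  proof -
    have "D = (\<Inter>k. {p. fst p $ k \<le> 1}) \<inter> {p. 1 < snd p}" by (auto simp: D_def)
    moreover have "convex {p :: (real ^ 'k) \<times> real. fst p $ k \<le> 1}" for k
      by (auto simp: convex_def intro: convex_bound_le)
    moreover have "convex {p :: (real ^ 'k) \<times> real. 1 < snd p}"
      using convex_halfspace_gt[of 1 "(0 :: real ^ 'k, 1 :: real)"] by (simp add: inner_prod_def)
    ultimately show ?thesis by (auto intro!: convex_Int convex_INT)
  qed
  moreover have "(0, 2) \<in> D" by (simp add: D_def)
  then have "D \<noteq> {}" by blast
  moreover have "C \<noteq> {}" "convex C"
    using zero by (auto simp: C_def)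
  ultimately obtain p c where p: "p \<noteq> 0" "\<And>z. z \<in> C \<Longrightarrow> inner p z \<le> c" "\<And>z. z \<in> D \<Longrightarrow> c \<le> inner p z"
    using separating_hyperplane_sets[of C D] by blast
  obtain a b where ab: "p = (a, b)" by fastforce
  have below: "inner a x + b * F x \<le> c" if "x \<in> nonneg_orthant" for x
    using p(2)[of "(x, F x)"] that by (auto simp: ab C_def hull_inc)
  have above: "c \<le> inner a y + b * t" if "\<And>k. y $ k \<le> 1" "1 < t" for y t
    using p(3)[of "(y, t)"] that by (auto simp: ab D_def)
  define s where "s = (\<Sum>k\<in>UNIV. a $ k)"
  have above_one: "c \<le> s + b * t" if "1 < t" for t
    using above[of 1 t] that by (simp add: inner_vec_def s_def)
  have b_nonneg: "0 \<le> b"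
  proof (rule ccontr)
    assume "\<not> 0 \<le> b"
    then have neg: "b < 0" by simp
    \<comment> \<open>\<open>(c - s) / b + 1\<close> is a height at which the functional is already below \<open>c\<close>;
      \<open>2\<close> keeps the point inside \<open>D\<close>.\<close>
    define t where "t = max 2 ((c - s) / b + 1)"
    have "b * t \<le> b * ((c - s) / b + 1)"
      using neg by (intro mult_left_mono_neg) (auto simp: t_def)
    also have "\<dots> = c - s + b" using neg by (simp add: distrib_left)
    also have "\<dots> < c - s" using neg by simp
    finally have "b * t < c - s" .
    moreover have "1 < t" by (simp add: t_def)
    then have "c - s \<le> b * t" using above_one[of t] by simp
    ultimately show False by simp
  qed
  have a_nonpos: "a $ k \<le> 0" for k
  proof (rule ccontr)
    assume "\<not> a $ k \<le> 0"
    then have pos: "0 < a $ k" by simp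
    \<comment> \<open>Going down by \<open>r\<close> in coordinate \<open>k\<close> from the point \<open>(1, \<dots>, 1)\<close> at height \<open>2\<close> stays in
      \<open>D\<close> and would take the functional below \<open>c\<close>.\<close>
    define r where "r = max 0 ((s + b * 2 - c) / a $ k + 1)"
    have "c \<le> inner a (1 - axis k r) + b * 2"
      by (rule above) (auto simp: axis_def r_def)
    also have "inner a (1 - axis k r) = s - a $ k * r"
      by (simp add: inner_diff_right inner_axis) (simp add: inner_vec_def s_def)
    finally have "a $ k * r \<le> s + b * 2 - c" by simp
    moreover have "a $ k * ((s + b * 2 - c) / a $ k + 1) \<le> a $ k * r"
      using pos by (intro mult_left_mono) (auto simp: r_def)
    ultimately show False using pos by (simp add: distrib_left)
  qed
  have b_pos: "0 < b"
  proof (rule ccontr)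
    assume "\<not> 0 < b"
    with b_nonneg have "b = 0" by simp
    with below[OF zero] above_one[of 2] have "0 \<le> s" by simp
    then have "(\<Sum>k\<in>UNIV. - a $ k) = 0"
      using a_nonpos by (intro antisym sum_nonneg) (auto simp: s_def sum_negf)
    then have "a = 0"
      using a_nonpos by (subst (asm) sum_nonneg_eq_0_iff) (auto simp: vec_eq_iff)
    with \<open>b = 0\<close> p(1) show False by (simp add: ab zero_prod_def)
  qed
  have "(c - s) / b \<le> t" if "1 < t" for t
    using above_one[OF that] b_pos by (simp add: pos_divide_le_eq mult.commute)
  then have "(c - s) / b \<le> 1" by (rule dense_ge)
  then have c_le: "c \<le> s + b" using b_pos by (simp add: field_simps)
  \<comment> \<open>The slack between \<open>c\<close> and \<open>s + b\<close> is added to the constant term, so that the weights sum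
    to exactly \<open>1\<close>.\<close>
  define w :: "real ^ 'k option"
    where "w = (\<chi> i. case i of Some k \<Rightarrow> - a $ k / b | None \<Rightarrow> 1 + s / b)"
  have mean_w: "weighted_mean w e = 1 + s / b - inner a e / b" for e
    by (simp add: weighted_mean_def w_def inner_vec_def sum_negf sum_divide_distrib)
  have dom: "F e \<le> weighted_mean w e" if "e \<in> nonneg_orthant" for e
  proof -
    have "F e \<le> (s + b - inner a e) / b"
      using below[OF that] c_le b_pos by (simp add: pos_le_divide_eq mult.commute)
    with b_pos show ?thesis by (simp add: mean_w add_divide_distrib diff_divide_distrib)
  qed
  have w_nonneg: "0 \<le> w $ i" for i
  proof (cases i)
    case None
    with F0 dom[OF zero] show ?thesis by (simp add: mean_w) (simp add: w_def)
  next
    case (Some k)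
    with a_nonpos[of k] b_pos show ?thesis by (simp add: w_def divide_nonpos_pos)
  qed
  have w_sum: "(\<Sum>i\<in>UNIV. w $ i) = 1"
    by (simp add: UNIV_option_conv sum.reindex w_def s_def sum_negf sum_divide_distrib)
  have "w $ i \<le> 1" for i
    using member_le_sum[of i UNIV "($) w"] w_nonneg w_sum by simp
  with w_nonneg w_sum have "w \<in> std_simplex" by (simp add: std_simplex_def)
  with dom show thesis using that by blast
qed

lemma e_merging_dominated:
  assumes "prob_space P" "atomless P" "e_merging P F"
  obtains w where "w \<in> std_simplex" "\<And>e. e \<in> nonneg_orthant \<Longrightarrow> F e \<le> weighted_mean w e"
proof (rule dominated_by_weighted_mean[of F])
  show "0 \<le> F 0"
    using assms(3) by (auto simp: e_merging_def nonneg_orthant_def)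
  show "(\<Sum>x\<in>S. u x * F x) \<le> 1"
    if "finite S" "S \<subseteq> nonneg_orthant" "\<And>x. x \<in> S \<Longrightarrow> 0 \<le> u x" "sum u S = 1"
      "\<And>k. (\<Sum>x\<in>S. u x * x $ k) \<le> 1" for S and u :: "_ \<Rightarrow> real"
    using e_merging_finite_mean_le_one[OF assms that(1), of "\<lambda>x. x" u] that(2-) by blast
qed (use that in blast)

section \<open>Weighted means are e-merging and mutually incomparable\<close>

lemma std_simplexD:
  assumes "w \<in> std_simplex"
  shows "0 \<le> w $ i" "(\<Sum>k\<in>UNIV. w $ Some k) + w $ None = 1"
proof -
  have "(\<Sum>i\<in>UNIV. w $ i) = w $ None + (\<Sum>k\<in>UNIV. w $ Some k)"
    by (simp add: UNIV_option_conv sum.reindex)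
  with assms show "0 \<le> w $ i" "(\<Sum>k\<in>UNIV. w $ Some k) + w $ None = 1"
    by (simp_all add: std_simplex_def)
qed

lemma weighted_mean_nonneg:
  assumes "w \<in> std_simplex" "e \<in> nonneg_orthant"
  shows "0 \<le> weighted_mean w e"
proof -
  have "0 \<le> (\<Sum>k\<in>UNIV. w $ Some k * e $ k)"
    using std_simplexD(1)[OF assms(1)] assms(2) unfolding nonneg_orthant_def
    by (intro sum_nonneg mult_nonneg_nonneg) blast+
  with std_simplexD(1)[OF assms(1), of None] show ?thesis
    unfolding weighted_mean_def by linarith
qed

text \<open>
  The value \<open>0\<close> that \<^const>\<open>enn2real\<close> gives to \<open>\<infinity>\<close> only decreases the integrand, so linearity of
  the integral bounds the expectation without an almost-sure finiteness argument.
\<close>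

lemma nn_integral_weighted_mean_le_one:
  fixes E :: "'k::finite \<Rightarrow> 'a \<Rightarrow> ennreal"
  assumes "prob_space P" "w \<in> std_simplex" "\<And>k. e_variable P (E k)"
  shows "(\<integral>\<^sup>+\<omega>. ennreal (weighted_mean w (\<chi> k. enn2real (E k \<omega>))) \<partial>P) \<le> 1"
proof -
  interpret prob_space P by fact
  note w = std_simplexD[OF assms(2)]
  have meas[measurable]: "E k \<in> borel_measurable P" and int: "(\<integral>\<^sup>+\<omega>. E k \<omega> \<partial>P) \<le> 1" for k
    using assms(3) by (auto simp: e_variable_def)
  have "ennreal (weighted_mean w (\<chi> k. enn2real (E k \<omega>)))
      \<le> (\<Sum>k\<in>UNIV. ennreal (w $ Some k) * E k \<omega>) + ennreal (w $ None)" for \<omega>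
  proof -
    have "ennreal (weighted_mean w (\<chi> k. enn2real (E k \<omega>)))
        = (\<Sum>k\<in>UNIV. ennreal (w $ Some k) * ennreal (enn2real (E k \<omega>))) + ennreal (w $ None)"
      using w(1) by (simp add: weighted_mean_def ennreal_plus sum_nonneg ennreal_mult flip: sum_ennreal)
    also have "\<dots> \<le> (\<Sum>k\<in>UNIV. ennreal (w $ Some k) * E k \<omega>) + ennreal (w $ None)"
      by (intro add_mono sum_mono mult_left_mono) (auto simp: ennreal_enn2real_if)
    finally show ?thesis .
  qed
  then have "(\<integral>\<^sup>+\<omega>. ennreal (weighted_mean w (\<chi> k. enn2real (E k \<omega>))) \<partial>P)
      \<le> (\<integral>\<^sup>+\<omega>. (\<Sum>k\<in>UNIV. ennreal (w $ Some k) * E k \<omega>) + ennreal (w $ None) \<partial>P)"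
    by (intro nn_integral_mono) auto
  also have "\<dots> = (\<Sum>k\<in>UNIV. ennreal (w $ Some k) * (\<integral>\<^sup>+\<omega>. E k \<omega> \<partial>P)) + ennreal (w $ None)"
    by (simp add: nn_integral_add nn_integral_sum nn_integral_cmult emeasure_space_1)
  also have "\<dots> \<le> (\<Sum>k\<in>UNIV. ennreal (w $ Some k) * 1) + ennreal (w $ None)"
    by (intro add_mono sum_mono mult_left_mono int) auto
  also have "\<dots> = ennreal ((\<Sum>k\<in>UNIV. w $ Some k) + w $ None)"
    using w(1) by (simp add: ennreal_plus sum_nonneg)
  finally show ?thesis using w(2) by simp
qed

lemma e_merging_if_eq_weighted_mean:
  fixes F :: "real ^ 'k \<Rightarrow> real"
  assumes "prob_space P" "w \<in> std_simplex"
    and eq: "\<And>e. e \<in> nonneg_orthant \<Longrightarrow> F e = weighted_mean w e"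
  shows "e_merging P F"
  unfolding e_merging_def
proof (intro conjI allI impI)
  note w = std_simplexD[OF assms(2)]
  show "F \<in> nonneg_orthant \<rightarrow> {0..}"
    using assms weighted_mean_nonneg[OF assms(2)] by (auto simp: eq)
  show "mono_on nonneg_orthant F"
    using w(1) by (auto intro!: mono_onI sum_mono mult_left_mono
        simp: eq weighted_mean_def less_eq_vec_def)
  have "weighted_mean w \<in> borel_measurable borel"
    unfolding weighted_mean_def
    by (intro borel_measurable_continuous_onI continuous_intros)
  then have "weighted_mean w \<in> borel_measurable (restrict_space borel nonneg_orthant)"
    by (rule measurable_restrict_space1)
  then show "F \<in> borel_measurable (restrict_space borel nonneg_orthant)"
    by (subst measurable_cong[where g = "weighted_mean w"]) (auto simp: eq space_restrict_space)
  fix E :: "'k \<Rightarrow> 'a \<Rightarrow> ennreal"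
  assume E: "\<forall>k. e_variable P (E k)"
  have F_eq: "F (\<chi> k. enn2real (E k \<omega>)) = weighted_mean w (\<chi> k. enn2real (E k \<omega>))" for \<omega>
    by (rule eq) (simp add: nonneg_orthant_def)
  have [measurable]: "E k \<in> borel_measurable P" for k
    using E by (auto simp: e_variable_def)
  have "(\<lambda>\<omega>. weighted_mean w (\<chi> k. enn2real (E k \<omega>))) \<in> borel_measurable P"
    unfolding weighted_mean_def by simp
  with nn_integral_weighted_mean_le_one[OF assms(1,2), of E] E
  show "e_variable P (\<lambda>\<omega>. ennreal (F (\<chi> k. enn2real (E k \<omega>))))"
    by (auto simp: e_variable_def F_eq)
qed

text \<open>
  Evaluation at the origin compares the constant terms, and growth along each axis compares the
  slopes, so every weight of \<open>v\<close> is at most that of \<open>w\<close>; equal sums then leave no room.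
\<close>

lemma weighted_mean_le_imp_eq:
  fixes v w :: "real ^ ('k::finite option)"
  assumes "v \<in> std_simplex" "w \<in> std_simplex"
    and le: "\<And>e. e \<in> nonneg_orthant \<Longrightarrow> weighted_mean v e \<le> weighted_mean w e"
  shows "v = w"
proof -
  have axis: "weighted_mean u (axis k r) = u $ Some k * r + u $ None" for u :: "real ^ 'k option" and k r
    by (simp add: weighted_mean_def axis_def if_distrib cong: if_cong)
  have coord: "v $ Some k * r + v $ None \<le> w $ Some k * r + w $ None" if "0 \<le> r" for k r
    using le[of "axis k r"] that by (simp add: axis) (simp add: nonneg_orthant_def axis_def)
  have None_le: "v $ None \<le> w $ None"
    using coord[of 0] by simp
  have Some_le: "v $ Some k \<le> w $ Some k" for k
  proof (rule ccontr)
    assume "\<not> ?thesis"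
    then have pos: "0 < v $ Some k - w $ Some k" by simp
    \<comment> \<open>Far enough out on the axis for the steeper slope to beat the constant terms by \<open>1\<close>.\<close>
    define r where "r = (w $ None - v $ None + 1) / (v $ Some k - w $ Some k)"
    have "(v $ Some k - w $ Some k) * r = w $ None - v $ None + 1"
      using pos by (simp add: r_def)
    moreover have "0 \<le> r" using None_le pos by (simp add: r_def)
    ultimately show False using coord[of r k] by (simp add: algebra_simps)
  qed
  have all_le: "v $ i \<le> w $ i" for i
    using None_le Some_le by (cases i) auto
  have "(\<Sum>i\<in>UNIV. w $ i - v $ i) = 0"
    using assms by (simp add: std_simplex_def sum_subtractf)
  then show "v = w"
    using all_le by (subst (asm) sum_nonneg_eq_0_iff) (auto simp: vec_eq_iff)
qed

section \<open>Characterization of admissible e-merging functions\<close>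

theorem theorem1:
  fixes P :: "'a measure" and F :: "real ^ 'k \<Rightarrow> real"
  assumes "prob_space P" and "atomless P"
    and "F \<in> nonneg_orthant \<rightarrow> {0..}"
  shows "(e_merging P F \<longrightarrow>
            (\<exists>w\<in>std_simplex. \<forall>e\<in>nonneg_orthant. F e \<le> weighted_mean w e)) \<and>
         (admissible_e_merging P F \<longleftrightarrow>
            (\<exists>w\<in>std_simplex. \<forall>e\<in>nonneg_orthant. F e = weighted_mean w e))"
proof (intro conjI impI iffI)
  assume "e_merging P F"
  then obtain w where "w \<in> std_simplex" "\<And>e. e \<in> nonneg_orthant \<Longrightarrow> F e \<le> weighted_mean w e"
    by (rule e_merging_dominated[OF assms(1,2)]) blast
  then show "\<exists>w\<in>std_simplex. \<forall>e\<in>nonneg_orthant. F e \<le> weighted_mean w e" by blast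
next
  assume adm: "admissible_e_merging P F"
  then have "e_merging P F" by (simp add: admissible_e_merging_def)
  then obtain w where w: "w \<in> std_simplex"
      "\<And>e. e \<in> nonneg_orthant \<Longrightarrow> F e \<le> weighted_mean w e"
    by (rule e_merging_dominated[OF assms(1,2)]) blast
  have "e_merging P (weighted_mean w)"
    using e_merging_if_eq_weighted_mean[OF assms(1) w(1)] by blast
  with adm w show "\<exists>w\<in>std_simplex. \<forall>e\<in>nonneg_orthant. F e = weighted_mean w e"
    unfolding admissible_e_merging_def by metis
next
  assume "\<exists>w\<in>std_simplex. \<forall>e\<in>nonneg_orthant. F e = weighted_mean w e"
  then obtain w where w: "w \<in> std_simplex"
      "\<And>e. e \<in> nonneg_orthant \<Longrightarrow> F e = weighted_mean w e" by blast
  show "admissible_e_merging P F"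
    unfolding admissible_e_merging_def
  proof (intro conjI allI impI ballI)
    show "e_merging P F"
      using e_merging_if_eq_weighted_mean[OF assms(1) w(1)] w(2) by blast
  next
    fix G and x :: "real ^ 'k"
    assume G: "e_merging P G" and ge: "\<forall>e\<in>nonneg_orthant. F e \<le> G e"
      and x: "x \<in> nonneg_orthant"
    obtain v where v: "v \<in> std_simplex"
        "\<And>e. e \<in> nonneg_orthant \<Longrightarrow> G e \<le> weighted_mean v e"
      by (rule e_merging_dominated[OF assms(1,2) G]) blast
    have "w = v"
    proof (rule weighted_mean_le_imp_eq[OF w(1) v(1)])
      show "weighted_mean w e \<le> weighted_mean v e" if "e \<in> nonneg_orthant" for e
        using ge w(2)[OF that] v(2)[OF that] that by fastforce
    qed
    with ge w(2)[OF x] v(2)[OF x] x show "G x = F x"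
      by (metis antisym)
  qed
qed

end
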